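(* Let $\omega$ be a $q$-th root of unity for some positive integer $q$. When $\omega\ne1$, for every $\varphi\in C_0^\infty(\mathbb{R})$, $$R_N^\omega(\varphi)\sim\sum_{n\ge1}c_n^\omega\frac{\varphi^{(n-1)}(0)}{N^n}\quad(N\to\infty),\qquad c_n^\omega=\sum_{\alpha=0}^{n-1}\sum_{k=0}^{\alpha}\frac{(n-k-1)!}{\alpha!\,(n-\alpha-1)!}\,\frac{p(\alpha,\alpha-k;\omega)}{(1-\omega)^{n-k}}.$$ When $\omega=1$, for every $\varphi\in\mathcal{S}(\mathbb{R})$, $$R_N([0,\infty);\varphi)\sim\int_0^\infty\varphi(x)\,dx+\sum_{n\ge1}c_n\frac{\varphi^{(n-1)}(0)}{N^n}\quad(N\to\infty),\qquad c_n=\sum_{\alpha=n}^{2n}\frac{(\alpha-n)!}{\alpha!}(-1)^{\alpha-n+1}p(\alpha,\alpha-n).$$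
   Context: For positive integers $N$, $R_N^\omega(\varphi)=\frac1N\sum_{k=0}^\infty\omega^k\varphi(k/N)$ and $R_N([0,\infty);\varphi)=\frac1N\sum_{k=0}^\infty\varphi(k/N)$. $C_0^\infty(\mathbb{R})$ and $\mathcal{S}(\mathbb{R})$ are the compactly supported smooth and the Schwartz functions. The Stirling numbers of the second kind $S(n,k)$ are given by $S(0,0)=1$, $S(n,0)=0$, $S(n,n)=1$ $(n\ge1)$, $S(n+1,k)=kS(n,k)+S(n,k-1)$ $(1\le k\le n)$. For integers $0\le k\le n$, $p(n,k;z)=\sum_{t=0}^k\binom nt(-1)^tS(n-t,k-t)z^{k-t}$ and $p(n,k)=p(n,k;1)$. $R_N\sim\sum_{n\ge0}a_nN^{-n}$ means $R_N-\sum_{n<M}a_nN^{-n}=O(N^{-M})$ as $N\to\infty$ for every $M\ge1$. *)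

theory Defs
  imports "HOL-Analysis.Analysis" "HOL-Library.Landau_Symbols" "HOL-Combinatorics.Stirling"
begin

section \<open>Smooth test functions on the real line\<close>

definition nth_deriv :: "nat \<Rightarrow> (real \<Rightarrow> complex) \<Rightarrow> real \<Rightarrow> complex" where
  "nth_deriv n \<phi> = ((\<lambda>f x. vector_derivative f (at x)) ^^ n) \<phi>"

definition smooth :: "(real \<Rightarrow> complex) \<Rightarrow> bool" where
  "smooth \<phi> \<longleftrightarrow> (\<forall>n x. nth_deriv n \<phi> differentiable at x)"

definition compactly_supported_smooth :: "(real \<Rightarrow> complex) set" where
  "compactly_supported_smooth = {\<phi>. smooth \<phi> \<and> compact (closure {x. \<phi> x \<noteq> 0})}"

definition schwartz :: "(real \<Rightarrow> complex) set" where
  "schwartz = {\<phi>. smooth \<phi> \<and> (\<forall>m n. bounded (range (\<lambda>x. x ^ m *\<^sub>R nth_deriv n \<phi> x)))}"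

section \<open>Riemann sums\<close>

definition twisted_riemann_sum :: "complex \<Rightarrow> nat \<Rightarrow> (real \<Rightarrow> complex) \<Rightarrow> complex" where
  "twisted_riemann_sum \<omega> N \<phi> = 1 / of_nat N * (\<Sum>k. \<omega> ^ k * \<phi> (real k / real N))"

definition riemann_sum :: "nat \<Rightarrow> (real \<Rightarrow> complex) \<Rightarrow> complex" where
  "riemann_sum N \<phi> = 1 / of_nat N * (\<Sum>k. \<phi> (real k / real N))"

section \<open>Coefficients\<close>

text \<open>The numbers \<open>S(n, k)\<close> are the library's \<^const>\<open>Stirling\<close>, whose defining equations
  are the recurrence together with \<open>S(0, 0) = 1\<close> and \<open>S(n, 0) = 0\<close> for \<open>n \<ge> 1\<close>.
  The definitions below are meant for \<open>k \<le> n\<close> (\<open>stirling_poly\<close>) and \<open>n \<ge> 1\<close> (the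
  coefficients); in that range no subtraction on the naturals truncates.\<close>

definition stirling_poly :: "nat \<Rightarrow> nat \<Rightarrow> complex \<Rightarrow> complex" where
  "stirling_poly n k z =
     (\<Sum>t\<le>k. of_nat (n choose t) * (-1) ^ t * of_nat (Stirling (n - t) (k - t)) * z ^ (k - t))"

definition twisted_coeff :: "complex \<Rightarrow> nat \<Rightarrow> complex" where
  "twisted_coeff \<omega> n =
     (\<Sum>\<alpha>=0..n-1. \<Sum>k=0..\<alpha>.
        fact (n - k - 1) / (fact \<alpha> * fact (n - \<alpha> - 1))
        * (stirling_poly \<alpha> (\<alpha> - k) \<omega> / (1 - \<omega>) ^ (n - k)))"

definition untwisted_coeff :: "nat \<Rightarrow> complex" where
  "untwisted_coeff n =
     (\<Sum>\<alpha>=n..2*n. fact (\<alpha> - n) / fact \<alpha> * (-1) ^ (\<alpha> - n + 1) * stirling_poly \<alpha> (\<alpha> - n) 1)"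

section \<open>Asymptotic expansions in inverse powers\<close>

definition asymptotic_expansion :: "(nat \<Rightarrow> complex) \<Rightarrow> (nat \<Rightarrow> complex) \<Rightarrow> bool" where
  "asymptotic_expansion R a \<longleftrightarrow>
     (\<forall>M\<ge>1. (\<lambda>N. R N - (\<Sum>n<M. a n / of_nat N ^ n)) \<in> O[sequentially](\<lambda>N. 1 / of_nat N ^ M))"

end

theory Submission
  imports Defs
begin

text \<open>
  Write \<open>T\<^sub>N(\<phi>)\<close> for the Riemann sum. Taylor expansion of \<open>\<phi>((k+1)/N)\<close> (for
  \<open>\<omega> \<noteq> 1\<close>), respectively of the integral of \<open>\<phi>\<close> over \<open>[k/N, (k+1)/N]\<close> (for \<open>\<omega> = 1\<close>),
  around \<open>k/N\<close> and summation over \<open>k\<close> expresses \<open>T\<^sub>N(\<phi>)\<close> up to \<open>O(N\<^sup>-\<^sup>M)\<close> by an explicit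
  term and the \<open>N\<^sup>-\<^sup>j T\<^sub>N(\<phi>\<^sup>(\<^sup>j\<^sup>))\<close> with \<open>1 \<le> j < M\<close>. By induction on \<open>M\<close> this yields an
  expansion whose coefficients satisfy the recurrences of the power series
  \<open>1 / (1 - \<omega>e\<^sup>x)\<close> and \<open>-x / (e\<^sup>x - 1)\<close>. The double sums in the statement are these
  coefficients, because the numbers \<open>p(n, k; z)\<close> have the exponential generating function
  \<open>(z(e\<^sup>x - 1) - x)\<^sup>k / k!\<close>.
\<close>

unbundle no vec_syntax
unbundle fps_syntax

section \<open>Generating functions of the coefficients\<close>

text \<open>With \<open>E = e^x - 1\<close> the derivative of \<open>E^k\<close> is
  \<open>k E^k + k E^(k-1)\<close>, because \<open>e^x = E + 1\<close>. Comparing coefficients gives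
  the Stirling recurrence, up to the factorials.\<close>

lemma fps_exp_minus_one_power_nth:
  "((fps_exp 1 - 1) ^ k :: 'a::field_char_0 fps) $ n = fact k * of_nat (Stirling n k) / fact n"
proof (induction n arbitrary: k)
  case 0
  show ?case by (cases k) (auto simp: fps_power_zeroth)
next
  case (Suc n)
  show ?case
  proof (cases k)
    case 0
    then show ?thesis by simp
  next
    case k: (Suc l)
    let ?E = "fps_exp 1 - 1 :: 'a fps"
    have "fps_deriv (?E ^ k) = of_nat k * fps_exp 1 * ?E ^ l"
      unfolding fps_deriv_power' by (simp add: k del: of_nat_Suc)
    also have "\<dots> = of_nat k * ?E ^ k + of_nat k * ?E ^ l"
      by (simp add: k algebra_simps del: of_nat_Suc)
    finally have "fps_deriv (?E ^ k) = of_nat k * ?E ^ k + of_nat k * ?E ^ l" .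
    then have "of_nat (Suc n) * (?E ^ k) $ Suc n = of_nat k * (?E ^ k) $ n + of_nat k * (?E ^ l) $ n"
      by (metis fps_add_nth fps_deriv_nth fps_mult_of_nat_nth(1) Suc_eq_plus1)
    then have "(?E ^ k) $ Suc n = (of_nat k * (fact k * of_nat (Stirling n k) / fact n) +
        of_nat k * (fact l * of_nat (Stirling n l) / fact n)) / of_nat (Suc n)"
      unfolding Suc.IH by (metis nonzero_mult_div_cancel_left of_nat_neq_0)
    also have "\<dots> = fact k * of_nat (Stirling (Suc n) k) / fact (Suc n)"
      by (simp add: k field_simps del: of_nat_Suc) (simp add: algebra_simps)
    finally show ?thesis .
  qed
qed

text \<open>Expand the power binomially: each \<open>(e^x - 1)^(k-t)\<close> contributes Stirling
  numbers, and the factor \<open>x^t\<close> shifts the index from \<open>n\<close> to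
  \<open>n - t\<close>.\<close>

lemma stirling_poly_egf:
  assumes "k \<le> n"
  shows "(fps_const z * (fps_exp 1 - 1) - fps_X) ^ k $ n = fact k * stirling_poly n k z / fact n"
proof -
  let ?E = "fps_exp 1 - 1 :: complex fps"
  have "(fps_const z * ?E - fps_X) ^ k = (- fps_X + fps_const z * ?E) ^ k"
    by simp
  also have "\<dots> = (\<Sum>t\<le>k. of_nat (k choose t) * (- fps_X) ^ t * (fps_const z * ?E) ^ (k - t))"
    by (rule binomial_ring)
  also have "\<dots> = (\<Sum>t\<le>k. fps_const (of_nat (k choose t) * (-1) ^ t * z ^ (k - t)) * (fps_X ^ t * ?E ^ (k - t)))"
    by (intro sum.cong refl)
       (simp add: power_minus[of fps_X] power_mult_distrib fps_const_power fps_of_nat[symmetric]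
         mult_ac fps_const_mult[symmetric] fps_const_neg[symmetric]
         del: fps_const_mult fps_const_neg flip: fps_const_power)
  finally have "(fps_const z * ?E - fps_X) ^ k $ n =
      (\<Sum>t\<le>k. of_nat (k choose t) * (-1) ^ t * z ^ (k - t) *
        (fact (k - t) * of_nat (Stirling (n - t) (k - t)) / fact (n - t)))"
    using assms by (simp add: fps_sum_nth fps_X_power_mult_nth fps_exp_minus_one_power_nth)
  \<comment> \<open>\<open>(k choose t) (k-t)! / (n-t)!\<close> equals
    \<open>(k! / n!) (n choose t)\<close>; this is how \<open>n choose t\<close> enters.\<close>
  also have "\<dots> = (\<Sum>t\<le>k. fact k / fact n * (of_nat (n choose t) * (-1) ^ t *
        of_nat (Stirling (n - t) (k - t)) * z ^ (k - t)))"
    using assms by (intro sum.cong refl) (simp add: binomial_fact field_simps)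
  finally show ?thesis
    by (simp add: stirling_poly_def sum_distrib_left sum_divide_distrib)
qed

text \<open>Here \<open>u = (e\<^sup>x - 1 - x) / x\<close>, and \<open>1 / (1 + u) = x / (e\<^sup>x - 1)\<close> is expanded geometrically.\<close>

lemma untwisted_coeff_eq_fps:
  fixes u :: "complex fps"
  defines "u \<equiv> Abs_fps (\<lambda>n. if n = 0 then 0 else 1 / fact (n + 1))"
  assumes "n \<le> K"
  shows "untwisted_coeff n = - (\<Sum>m\<le>K. (- u) ^ m) $ n"
proof -
  have Xu: "fps_const 1 * (fps_exp 1 - 1) - fps_X = fps_X * u"
    by (rule fps_ext) (auto simp: u_def fps_X_nth fps_X_mult_nth le_Suc_eq)
  \<comment> \<open>Since \<open>e^x - 1 - x = x u\<close>, the factor \<open>x^m\<close> moves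
    coefficient \<open>n + m\<close> of the \<open>m\<close>-th power to coefficient
    \<open>n\<close> of \<open>u^m\<close>.\<close>
  have p: "stirling_poly (n + m) m 1 = fact (n + m) / fact m * (u ^ m) $ n" for m
    using stirling_poly_egf[of m "n + m" 1]
    unfolding Xu power_mult_distrib by (simp add: fps_X_power_mult_nth field_simps)
  have "untwisted_coeff n = (\<Sum>m\<le>n. fact m / fact (n + m) * (-1) ^ (m + 1) * stirling_poly (n + m) m 1)"
    unfolding untwisted_coeff_def
    by (rule sum.reindex_bij_witness[of _ "\<lambda>m. n + m" "\<lambda>a. a - n"]) auto
  also have "\<dots> = (\<Sum>m\<le>n. - ((- u) ^ m) $ n)"
    by (intro sum.cong refl) (simp add: p power_minus[of u] fps_mult_nth_0 minus_one_power_iff)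
  \<comment> \<open>\<open>u\<close> has no constant term, so powers beyond \<open>n\<close> do not
    reach coefficient \<open>n\<close>. The free bound \<open>K\<close> lets one partial sum serve
    all coefficients up to \<open>K\<close>.\<close>
  also have "\<dots> = (\<Sum>m\<le>K. - ((- u) ^ m) $ n)"
    using assms(2) startsby_zero_power_prefix[of "- u"]
    by (intro sum.mono_neutral_left) (auto simp: u_def)
  finally show ?thesis by (simp add: fps_sum_nth sum_negf)
qed

text \<open>The coefficients of \<open>1 + u\<close> are \<open>1 / (j + 1)!\<close>. Its product
  with the partial geometric sum \<open>G\<close> is \<open>1\<close> up to
  \<open>(-u)^(n+1)\<close>, which starts at degree \<open>n + 1\<close>; compare coefficients of
  degree \<open>n\<close>.\<close>

lemma untwisted_coeff_rec:
  "(\<Sum>j\<le>n. untwisted_coeff (n - j) / fact (j + 1)) = (if n = 0 then - 1 else 0)"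
proof -
  define u :: "complex fps" where "u = Abs_fps (\<lambda>n. if n = 0 then 0 else 1 / fact (n + 1))"
  define G where "G = (\<Sum>m\<le>n. (- u) ^ m)"
  have "(1 + u) * G = 1 - (- u) ^ Suc n"
    using one_diff_power_eq[of "- u" "Suc n"] by (simp add: G_def lessThan_Suc_atMost)
  then have "((1 + u) * G) $ n = (if n = 0 then 1 else 0)"
    using startsby_zero_power_prefix[of "- u" "Suc n"] by (simp add: u_def)
  moreover have "untwisted_coeff j = - G $ j" if "j \<le> n" for j
    using untwisted_coeff_eq_fps[OF that] by (simp add: G_def u_def)
  then have "((1 + u) * G) $ n = - (\<Sum>j\<le>n. untwisted_coeff (n - j) / fact (j + 1))"
    by (auto simp: fps_mult_nth atMost_atLeast0 u_def sum_negf[symmetric] intro!: sum.cong)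
  ultimately show ?thesis by (auto simp: minus_equation_iff equation_minus_iff)
qed

text \<open>With \<open>W = 1 - \<omega>e\<^sup>x + x\<close>, the right-hand side is a partial sum of the geometric series
  for \<open>1 / (W - x) = 1 / (1 - \<omega>e\<^sup>x)\<close> in powers of \<open>x / W\<close>.\<close>

lemma twisted_coeff_eq_fps:
  fixes \<omega> :: complex
  defines "Q \<equiv> inverse (1 - fps_const \<omega> * fps_exp 1 + fps_X)"
  assumes \<omega>: "\<omega> \<noteq> 1" and "n < K"
  shows "twisted_coeff \<omega> (Suc n) = (\<Sum>b<K. fps_X ^ b * Q ^ Suc b) $ n"
proof -
  define c where "c = 1 - \<omega>"
  have c: "c \<noteq> 0" using \<omega> by (simp add: c_def)
  define v where "v = fps_const \<omega> * (fps_exp 1 - 1) - fps_X"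
  have v0: "v $ 0 = 0" by (simp add: v_def)
  \<comment> \<open>The denominator equals \<open>c - v\<close> with \<open>c \<noteq> 0\<close>,
    and \<open>v\<close> has no constant term. So powers of \<open>Q\<close> become negative
    binomial series composed with \<open>v\<close>.\<close>
  have Qv: "Q = fps_const (1 / c) * inverse (1 - fps_const (1 / c) * v)"
  proof -
    have "1 - fps_const \<omega> * fps_exp 1 + fps_X = fps_const c * (1 - fps_const (1 / c) * v)"
      using c by (simp add: right_diff_distrib mult.assoc[symmetric]) (simp add: v_def c_def algebra_simps flip: fps_const_sub)
    then show ?thesis
      unfolding Q_def using c by (simp add: fps_inverse_mult fps_const_inverse divide_inverse)
  qed
  define A where "A b = Abs_fps (\<lambda>m. of_nat ((b + m) choose m) * (1 / c) ^ m)" for b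
  have QA: "Q ^ Suc b = fps_const (1 / c ^ Suc b) * (A b oo v)" for b
  proof -
    let ?L = "1 - fps_const (1 / c) * fps_X"
    have "A b = inverse (?L ^ Suc b)"
      unfolding A_def by (subst one_minus_const_fps_X_neg_power') auto
    then have "?L ^ Suc b * A b = 1"
      by (simp add: inverse_mult_eq_1' fps_power_zeroth del: power_Suc)
    then have "(?L ^ Suc b oo v) * (A b oo v) = 1"
      by (simp flip: fps_compose_mult_distrib[OF v0])
    moreover have "?L ^ Suc b oo v = (1 - fps_const (1 / c) * v) ^ Suc b"
      unfolding fps_compose_power[OF v0, symmetric]
      by (simp add: fps_compose_sub_distrib fps_compose_mult_distrib[OF v0] v0 del: power_Suc)
    ultimately have "inverse ((1 - fps_const (1 / c) * v) ^ Suc b) = A b oo v"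
      by (simp add: fps_inverse_unique del: power_Suc)
    then show ?thesis
      by (simp add: Qv power_mult_distrib fps_inverse_power power_one_over del: power_Suc)
  qed
  \<comment> \<open>Put \<open>b = n - \<alpha>\<close> and \<open>m = \<alpha> - k\<close>. Then
    \<open>b + m = n - k\<close>, and the factorials combine to the binomial coefficient in
    \<open>A b $ m\<close>.\<close>
  have "fact (Suc n - k - 1) / (fact \<alpha> * fact (Suc n - \<alpha> - 1)) * (stirling_poly \<alpha> (\<alpha> - k) \<omega> / c ^ (Suc n - k))
    = 1 / c ^ Suc (n - \<alpha>) * (A (n - \<alpha>) $ (\<alpha> - k) * (v ^ (\<alpha> - k)) $ \<alpha>)"
    if "\<alpha> \<le> n" "k \<le> \<alpha>" for k \<alpha>
  proof -
    have "n - \<alpha> + (\<alpha> - k) = n - k" using that by simp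
    moreover have "c ^ Suc (n - k) = c ^ Suc (n - \<alpha>) * c ^ (\<alpha> - k)"
      using that by (simp flip: power_add power_Suc)
    moreover have "stirling_poly \<alpha> (\<alpha> - k) \<omega> = fact \<alpha> / fact (\<alpha> - k) * (v ^ (\<alpha> - k)) $ \<alpha>"
      using stirling_poly_egf[of "\<alpha> - k" \<alpha> \<omega>] by (simp add: v_def)
    ultimately show ?thesis
      using that c by (simp add: A_def binomial_fact Suc_diff_le field_simps del: power_Suc)
  qed
  then have "twisted_coeff \<omega> (Suc n) = (\<Sum>\<alpha>\<le>n. \<Sum>k\<le>\<alpha>. 1 / c ^ Suc (n - \<alpha>) * (A (n - \<alpha>) $ (\<alpha> - k) * (v ^ (\<alpha> - k)) $ \<alpha>))"
    by (auto simp: twisted_coeff_def c_def atMost_atLeast0 intro!: sum.cong)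
  also have "\<dots> = (\<Sum>\<alpha>\<le>n. (Q ^ Suc (n - \<alpha>)) $ \<alpha>)"
  proof (rule sum.cong[OF refl])
    fix \<alpha>
    have "(\<Sum>k\<le>\<alpha>. A (n - \<alpha>) $ (\<alpha> - k) * (v ^ (\<alpha> - k)) $ \<alpha>) = (A (n - \<alpha>) oo v) $ \<alpha>"
      unfolding fps_compose_nth atLeast0AtMost
      by (rule sum.reindex_bij_witness[of _ "\<lambda>k. \<alpha> - k" "\<lambda>k. \<alpha> - k"]) auto
    then show "(\<Sum>k\<le>\<alpha>. 1 / c ^ Suc (n - \<alpha>) * (A (n - \<alpha>) $ (\<alpha> - k) * (v ^ (\<alpha> - k)) $ \<alpha>)) = (Q ^ Suc (n - \<alpha>)) $ \<alpha>"
      unfolding QA by (simp add: sum_divide_distrib[symmetric] del: power_Suc)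
  qed
  also have "\<dots> = (\<Sum>b\<le>n. (Q ^ Suc b) $ (n - b))"
    by (rule sum.reindex_bij_witness[of _ "\<lambda>k. n - k" "\<lambda>k. n - k"]) auto
  \<comment> \<open>The factor \<open>x^b\<close> removes all terms with \<open>b > n\<close>, so
    every \<open>K > n\<close> gives the same coefficient.\<close>
  also have "\<dots> = (\<Sum>b<K. (fps_X ^ b * Q ^ Suc b) $ n)"
    unfolding fps_X_power_mult_nth using \<open>n < K\<close> by (intro sum.mono_neutral_cong_left) auto
  finally show ?thesis by (simp add: fps_sum_nth del: power_Suc)
qed

text \<open>Since \<open>W Q = 1\<close>, multiplying the partial sum \<open>G\<close> by
  \<open>W - x = 1 - \<omega> e^x\<close> telescopes to \<open>1 - (x Q)^(n+1)\<close>, whose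
  coefficient \<open>n\<close> is that of \<open>1\<close>.\<close>

lemma twisted_coeff_rec:
  assumes \<omega>: "\<omega> \<noteq> 1"
  shows "twisted_coeff \<omega> (Suc n) - \<omega> * (\<Sum>j\<le>n. twisted_coeff \<omega> (Suc (n - j)) / fact j) =
    (if n = 0 then 1 else 0)"
proof -
  define W where "W = 1 - fps_const \<omega> * fps_exp 1 + fps_X"
  define Q where "Q = inverse W"
  define G where "G = (\<Sum>b<Suc n. fps_X ^ b * Q ^ Suc b)"
  have "W $ 0 \<noteq> 0" using \<omega> by (simp add: W_def)
  then have WQ: "W * Q = 1" by (simp add: Q_def inverse_mult_eq_1')
  have "(W - fps_X) * G = (\<Sum>b<Suc n. fps_X ^ b * Q ^ b - fps_X ^ Suc b * Q ^ Suc b)"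
    unfolding G_def sum_distrib_left
  proof (intro sum.cong refl)
    fix b
    have "(W - fps_X) * (fps_X ^ b * Q ^ Suc b) = fps_X ^ b * Q ^ b * (W * Q) - fps_X ^ Suc b * Q ^ Suc b"
      by (simp add: algebra_simps)
    then show "(W - fps_X) * (fps_X ^ b * Q ^ Suc b) = fps_X ^ b * Q ^ b - fps_X ^ Suc b * Q ^ Suc b"
      by (simp add: WQ)
  qed
  also have "\<dots> = 1 - fps_X ^ Suc n * Q ^ Suc n"
    by (subst sum_lessThan_telescope') simp
  finally have "((1 - fps_const \<omega> * fps_exp 1) * G) $ n = (if n = 0 then 1 else 0)"
    by (simp add: W_def fps_X_power_mult_nth del: power_Suc)
  moreover have "((1 - fps_const \<omega> * fps_exp 1) * G) $ n = G $ n - \<omega> * (fps_exp 1 * G) $ n"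
    by (simp add: left_diff_distrib mult.assoc)
  moreover have "(fps_exp 1 * G) $ n = (\<Sum>j\<le>n. twisted_coeff \<omega> (Suc (n - j)) / fact j)"
    by (auto simp: fps_mult_nth atMost_atLeast0 G_def Q_def W_def
        twisted_coeff_eq_fps[OF \<omega>, of _ "Suc n"] intro!: sum.cong)
  moreover have "G $ n = twisted_coeff \<omega> (Suc n)"
    by (simp add: G_def Q_def W_def twisted_coeff_eq_fps[OF \<omega>, of _ "Suc n"] del: sum.lessThan_Suc)
  ultimately show ?thesis by simp
qed

section \<open>Schwartz functions and their Riemann sums\<close>

lemma nth_deriv_0 [simp]: "nth_deriv 0 f = f"
  by (simp add: nth_deriv_def)

lemma nth_deriv_Suc: "nth_deriv (Suc n) f = (\<lambda>x. vector_derivative (nth_deriv n f) (at x))"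
  by (simp add: nth_deriv_def)

lemma nth_deriv_nth_deriv [simp]: "nth_deriv m (nth_deriv n f) = nth_deriv (m + n) f"
  by (simp add: nth_deriv_def funpow_add)

lemma smooth_has_vector_derivative:
  assumes "smooth f"
  shows "(nth_deriv n f has_vector_derivative nth_deriv (Suc n) f x) (at x within A)"
  using assms unfolding smooth_def nth_deriv_Suc
  by (auto intro!: has_vector_derivative_at_within vector_derivative_works[THEN iffD1])

lemma smooth_continuous_on:
  assumes "smooth f"
  shows "continuous_on A (nth_deriv n f)"
  by (rule continuous_on_vector_derivative) (rule smooth_has_vector_derivative[OF assms])

lemma schwartz_imp_smooth: "f \<in> schwartz \<Longrightarrow> smooth f"
  by (simp add: schwartz_def)

lemma nth_deriv_in_schwartz: "f \<in> schwartz \<Longrightarrow> nth_deriv n f \<in> schwartz"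
  by (simp add: schwartz_def smooth_def)

text \<open>All derivatives vanish on the open complement of the closed support, and on the support
  compactness and continuity bound them.\<close>

lemma compactly_supported_smooth_subset_schwartz: "compactly_supported_smooth \<subseteq> schwartz"
proof
  fix f assume "f \<in> compactly_supported_smooth"
  then have f: "smooth f" and K: "compact (closure {x. f x \<noteq> 0})"
    by (auto simp: compactly_supported_smooth_def)
  define K where "K = closure {x. f x \<noteq> 0}"
  have zero: "nth_deriv n f x = 0" if "x \<notin> K" for n x
    using that
  proof (induction n arbitrary: x)
    case 0
    then show ?case using closure_subset[of "{x. f x \<noteq> 0}"] by (auto simp: K_def)
  next
    case (Suc n)
    have "(nth_deriv n f has_vector_derivative 0) (at x)"
    proof (rule has_vector_derivative_transform_within_open)
      show "((\<lambda>_. 0) has_vector_derivative 0) (at x)" by simp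
      show "open (- K)" by (simp add: K_def open_Compl)
      show "x \<in> - K" using Suc.prems by simp
      show "0 = nth_deriv n f y" if "y \<in> - K" for y using Suc.IH[of y] that by simp
    qed
    then show ?case by (simp add: nth_deriv_Suc vector_derivative_at)
  qed
  have "bounded (range (\<lambda>x. x ^ m *\<^sub>R nth_deriv n f x))" for m n
  proof -
    have "compact ((\<lambda>x. x ^ m *\<^sub>R nth_deriv n f x) ` K)"
      using K by (intro compact_continuous_image continuous_intros smooth_continuous_on f) (simp add: K_def)
    then have "bounded (insert 0 ((\<lambda>x. x ^ m *\<^sub>R nth_deriv n f x) ` K))"
      by (simp add: compact_imp_bounded)
    moreover have "x ^ m *\<^sub>R nth_deriv n f x \<in> insert 0 ((\<lambda>x. x ^ m *\<^sub>R nth_deriv n f x) ` K)" for x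
      using zero[of x n] by (cases "x \<in> K") auto
    ultimately show ?thesis
      by (meson bounded_subset image_subsetI)
  qed
  then show "f \<in> schwartz" using f by (simp add: schwartz_def)
qed

text \<open>Quadratic decay is enough for the grid sums and the integrals to converge absolutely. It
  follows from the seminorm bounds for \<open>m = 0\<close> and \<open>m = 2\<close>, as
  \<open>(1 + x)^2 \<le> 2 (1 + x^2)\<close>.\<close>

lemma schwartz_decay:
  assumes "f \<in> schwartz"
  obtains B where "B > 0" "\<And>x. x \<ge> 0 \<Longrightarrow> norm (nth_deriv n f x) \<le> B / (1 + x)\<^sup>2"
proof -
  have bdd: "\<exists>B>0. \<forall>x. norm (x ^ m *\<^sub>R nth_deriv n f x) \<le> B" for m
    using assms by (simp add: schwartz_def bounded_pos)
  obtain B0 where B0: "B0 > 0" "\<And>x. norm (nth_deriv n f x) \<le> B0"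
    using bdd[of 0] by auto
  obtain B2 where B2: "B2 > 0" "\<And>x. x\<^sup>2 * norm (nth_deriv n f x) \<le> B2"
    using bdd[of 2] by auto
  show ?thesis
  proof
    show "2 * (B0 + B2) > 0" using B0 B2 by simp
    fix x :: real assume x: "x \<ge> 0"
    have "(1 + x)\<^sup>2 * norm (nth_deriv n f x) \<le> (2 * (1 + x\<^sup>2)) * norm (nth_deriv n f x)"
      using sum_squares_ge_zero[of "1 - x" 0]
      by (intro mult_right_mono) (auto simp: power2_eq_square algebra_simps)
    also have "\<dots> \<le> 2 * (B0 + B2)"
      using B0(2)[of x] B2(2)[of x] by (simp add: algebra_simps)
    finally show "norm (nth_deriv n f x) \<le> 2 * (B0 + B2) / (1 + x)\<^sup>2"
      using x by (simp add: field_simps)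
  qed
qed

text \<open>The factor \<open>1 / (p-1)!\<close> in the integral remainder is bounded crudely by
  \<open>1\<close>, since only the order \<open>(b - a)^p\<close> matters. The family
  \<open>D\<close> is abstract so that a primitive can serve as \<open>D 0\<close>.\<close>

lemma Taylor_remainder_le:
  fixes D :: "nat \<Rightarrow> real \<Rightarrow> 'a::banach"
  assumes "p > 0" "a \<le> b" "B \<ge> 0"
    and D: "\<And>m t. m < p \<Longrightarrow> t \<in> {a..b} \<Longrightarrow> (D m has_vector_derivative D (Suc m) t) (at t within {a..b})"
    and B: "\<And>t. t \<in> {a..b} \<Longrightarrow> norm (D p t) \<le> B"
  shows "norm (D 0 b - (\<Sum>i<p. ((b - a) ^ i / fact i) *\<^sub>R D i a)) \<le> B * (b - a) ^ p"
proof -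
  let ?i = "\<lambda>x. ((b - x) ^ (p - 1) / fact (p - 1)) *\<^sub>R D p x"
  have "(?i has_integral D 0 b - (\<Sum>i<p. ((b - a) ^ i / fact i) *\<^sub>R D i a)) {a..b}"
    using assms by (intro Taylor_has_integral[of p D "D 0" a b]) auto
  moreover have "norm (?i x) \<le> (b - a) ^ (p - 1) * B" if "x \<in> {a..b}" for x
  proof -
    have "(b - x) ^ (p - 1) / fact (p - 1) \<le> (b - a) ^ (p - 1) / 1"
      using that by (intro frac_le power_mono) auto
    then have "(b - x) ^ (p - 1) / fact (p - 1) * norm (D p x) \<le> (b - a) ^ (p - 1) * B"
      using B[OF that] that by (intro mult_mono) auto
    then show ?thesis
      using that by simp
  qed
  ultimately have "norm (D 0 b - (\<Sum>i<p. ((b - a) ^ i / fact i) *\<^sub>R D i a)) \<le> (b - a) ^ (p - 1) * B * measure lborel {a..b}"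
    using assms by (intro has_integral_bound_real[where S = "{}"]) auto
  also have "\<dots> = B * (b - a) ^ p"
    using assms by (cases p) auto
  finally show ?thesis .
qed

section \<open>Absolutely convergent sums over the grid \<open>k / N\<close>\<close>

lemma
  assumes "N > 0"
  shows summable_inverse_square_grid: "summable (\<lambda>k. 1 / (1 + real k / real N)\<^sup>2)"
    and suminf_inverse_square_grid_le: "(\<Sum>k. 1 / (1 + real k / real N)\<^sup>2) \<le> 2 * real N"
proof -
  \<comment> \<open>A telescoping majorant: with \<open>s = N + k \<ge> 1\<close>,
    \<open>1 / s^2 \<le> 2 / (s (s + 1))\<close>, and the total is \<open>2 N^2 / N\<close>.\<close>
  let ?g = "\<lambda>k. 2 * (real N)\<^sup>2 * (1 / (real N + real k) - 1 / (real N + real (Suc k)))"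
  have "(\<lambda>k. 1 / (real N + real k)) \<longlonglongrightarrow> 0"
    by (intro real_tendsto_divide_at_top[OF tendsto_const] filterlim_tendsto_add_at_top[OF tendsto_const]
        filterlim_real_sequentially)
  from sums_mult[OF telescope_sums'[OF this], of "2 * (real N)\<^sup>2"]
  have g: "?g sums (2 * real N)"
    using assms by (simp add: power2_eq_square)
  have le: "1 / (1 + real k / real N)\<^sup>2 \<le> ?g k" for k
  proof -
    define s where "s = real N + real k"
    have s: "s \<ge> 1" using assms by (simp add: s_def)
    have "1 / (1 + real k / real N)\<^sup>2 = (real N)\<^sup>2 * (1 / (s * s))"
      using assms by (simp add: s_def power2_eq_square field_simps)
    also have "\<dots> \<le> (real N)\<^sup>2 * (2 / (s * (s + 1)))"
      using s by (intro mult_left_mono) (auto simp: divide_simps)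
    also have "\<dots> = ?g k"
      using s by (simp add: field_simps flip: s_def)
    finally show ?thesis .
  qed
  show S: "summable (\<lambda>k. 1 / (1 + real k / real N)\<^sup>2)"
    using le by (intro summable_comparison_test[OF _ sums_summable[OF g]]) auto
  show "(\<Sum>k. 1 / (1 + real k / real N)\<^sup>2) \<le> 2 * real N"
    using suminf_le[OF le S sums_summable[OF g]] sums_unique[OF g] by simp
qed

text \<open>For summing Taylor remainders. The factor \<open>N\<close> in the bound is offset by the
  prefactor \<open>1 / N\<close> in the twisted case, and by the extra power of the step size gained
  by integration in the untwisted case.\<close>

lemma
  fixes g :: "nat \<Rightarrow> complex"
  assumes "N > 0" and g: "\<And>k. norm (g k) \<le> B / (1 + real k / real N)\<^sup>2"
  shows summable_grid_decay: "summable g"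
    and norm_suminf_grid_decay_le: "norm (suminf g) \<le> 2 * B * real N"
proof -
  have S: "summable (\<lambda>k. B * (1 / (1 + real k / real N)\<^sup>2))"
    by (intro summable_mult summable_inverse_square_grid assms)
  then have S': "summable (\<lambda>k. norm (g k))"
    using g by (intro summable_comparison_test[OF _ S]) auto
  then show "summable g" by (rule summable_norm_cancel)
  have "0 \<le> B" using g[of 0] order_trans[OF norm_ge_zero] by fastforce
  have "norm (suminf g) \<le> (\<Sum>k. norm (g k))" by (rule summable_norm[OF S'])
  also have "\<dots> \<le> (\<Sum>k. B * (1 / (1 + real k / real N)\<^sup>2))"
    using g by (intro suminf_le S S') simp
  also have "\<dots> \<le> B * (2 * real N)"
    by (subst suminf_mult[OF summable_inverse_square_grid[OF assms(1)]])
       (intro mult_left_mono suminf_inverse_square_grid_le assms \<open>0 \<le> B\<close>)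
  finally show "norm (suminf g) \<le> 2 * B * real N" by simp
qed

lemma schwartz_summable_grid:
  assumes "f \<in> schwartz" "norm \<omega> = 1" "N > 0"
  shows "summable (\<lambda>k. \<omega> ^ k * f (real k / real N))"
proof -
  obtain B where "\<And>x. x \<ge> 0 \<Longrightarrow> norm (f x) \<le> B / (1 + x)\<^sup>2"
    using schwartz_decay[OF assms(1), of 0] by auto
  then show ?thesis
    using assms by (intro summable_grid_decay[where B = B and N = N]) (auto simp: norm_mult norm_power)
qed

text \<open>The bound on the \<open>M\<close>-th derivative decreases on \<open>[x, x + h]\<close>,
  so its value at the left endpoint controls the remainder. \<open>B\<close> is uniform in
  \<open>x\<close> and \<open>h\<close>.\<close>

lemma schwartz_Taylor_step:
  assumes f: "f \<in> schwartz" and "M > 0"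
  obtains B where "\<And>x h. x \<ge> 0 \<Longrightarrow> h \<ge> 0 \<Longrightarrow>
    norm (f (x + h) - (\<Sum>j<M. (h ^ j / fact j) *\<^sub>R nth_deriv j f x)) \<le> B * h ^ M / (1 + x)\<^sup>2"
proof -
  obtain B where B: "B > 0" "\<And>x. x \<ge> 0 \<Longrightarrow> norm (nth_deriv M f x) \<le> B / (1 + x)\<^sup>2"
    using schwartz_decay[OF f] by metis
  show ?thesis
  proof
    fix x h :: real assume xh: "x \<ge> 0" "h \<ge> 0"
    have "norm (nth_deriv M f t) \<le> B / (1 + x)\<^sup>2" if "t \<in> {x..x + h}" for t
    proof -
      have "B / (1 + t)\<^sup>2 \<le> B / (1 + x)\<^sup>2"
        using that B(1) xh by (intro divide_left_mono power_mono) auto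
      with B(2)[of t] that xh show ?thesis by auto
    qed
    then have "norm (nth_deriv 0 f (x + h) - (\<Sum>j<M. ((x + h - x) ^ j / fact j) *\<^sub>R nth_deriv j f x))
        \<le> B / (1 + x)\<^sup>2 * (x + h - x) ^ M"
      using xh B(1) assms
      by (intro Taylor_remainder_le smooth_has_vector_derivative schwartz_imp_smooth) auto
    then show "norm (f (x + h) - (\<Sum>j<M. (h ^ j / fact j) *\<^sub>R nth_deriv j f x)) \<le> B * h ^ M / (1 + x)\<^sup>2"
      by simp
  qed
qed

text \<open>Taylor expansion of the primitive: \<open>D\<close> starts with the integral of
  \<open>f\<close> from \<open>0\<close> and continues with \<open>f\<close> and its derivatives,
  which shifts the order by one and gains a power of \<open>h\<close>.\<close>

lemma schwartz_Taylor_step_integral: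
  assumes f: "f \<in> schwartz"
  obtains B where "\<And>x h. x \<ge> 0 \<Longrightarrow> h \<ge> 0 \<Longrightarrow>
    norm (integral {0..x + h} f - integral {0..x} f - (\<Sum>j<M. (h ^ Suc j / fact (Suc j)) *\<^sub>R nth_deriv j f x))
      \<le> B * h ^ Suc M / (1 + x)\<^sup>2"
proof -
  obtain B where B: "B > 0" "\<And>x. x \<ge> 0 \<Longrightarrow> norm (nth_deriv M f x) \<le> B / (1 + x)\<^sup>2"
    using schwartz_decay[OF f] by metis
  define D where "D j = (case j of 0 \<Rightarrow> \<lambda>x. integral {0..x} f | Suc i \<Rightarrow> nth_deriv i f)" for j
  show ?thesis
  proof
    fix x h :: real assume xh: "x \<ge> 0" "h \<ge> 0"
    have "norm (D (Suc M) t) \<le> B / (1 + x)\<^sup>2" if "t \<in> {x..x + h}" for t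
    proof -
      have "B / (1 + t)\<^sup>2 \<le> B / (1 + x)\<^sup>2"
        using that B(1) xh by (intro divide_left_mono power_mono) auto
      with B(2)[of t] that xh show ?thesis by (auto simp: D_def)
    qed
    moreover have "(D j has_vector_derivative D (Suc j) t) (at t within {x..x + h})"
      if "t \<in> {x..x + h}" for t j
    proof (cases j)
      case 0
      have "continuous_on {0..x + h} f"
        using smooth_continuous_on[OF schwartz_imp_smooth[OF f], of _ 0] by simp
      then have "((\<lambda>x. integral {0..x} f) has_vector_derivative f t) (at t within {0..x + h})"
        using that xh by (intro integral_has_vector_derivative) auto
      then show ?thesis
        using xh by (auto simp: D_def 0 intro: has_vector_derivative_within_subset)
    next
      case (Suc i)
      then show ?thesis
        using smooth_has_vector_derivative[OF schwartz_imp_smooth[OF f]] by (simp add: D_def)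
    qed
    ultimately have "norm (D 0 (x + h) - (\<Sum>j<Suc M. ((x + h - x) ^ j / fact j) *\<^sub>R D j x))
        \<le> B / (1 + x)\<^sup>2 * (x + h - x) ^ Suc M"
      using xh B(1) by (intro Taylor_remainder_le) auto
    then show "norm (integral {0..x + h} f - integral {0..x} f -
        (\<Sum>j<M. (h ^ Suc j / fact (Suc j)) *\<^sub>R nth_deriv j f x)) \<le> B * h ^ Suc M / (1 + x)\<^sup>2"
      by (simp add: D_def sum.lessThan_Suc_shift diff_diff_eq del: power_Suc fact_Suc sum.lessThan_Suc)
  qed
qed

section \<open>Integrals over the half-line\<close>

lemma set_integrable_inverse_square: "set_integrable lborel {0..} (\<lambda>x::real. 1 / (1 + x)\<^sup>2)"
proof -
  have "((\<lambda>x::real. - 1 / (1 + x)) \<longlongrightarrow> 0) at_top"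
    by (intro real_tendsto_divide_at_top[OF tendsto_const]
        filterlim_tendsto_add_at_top[OF tendsto_const] filterlim_ident)
  then have "(\<integral>\<^sup>+x. ennreal (1 / (1 + x)\<^sup>2) * indicator {0..} x \<partial>lborel) = 0 - - 1 / (1 + 0 :: real)"
    by (intro nn_integral_FTC_atLeast)
       (auto intro!: derivative_eq_intros simp: power2_eq_square divide_simps)
  then show ?thesis
    unfolding set_integrable_def
    by (intro integrableI_nonneg)
       (auto simp: indicator_mult_ennreal mult.commute nn_integral_set_ennreal)
qed

lemma schwartz_set_integrable:
  assumes f: "f \<in> schwartz"
  shows "set_integrable lborel {0..} f"
proof -
  obtain B where B: "B > 0" "\<And>x. x \<ge> 0 \<Longrightarrow> norm (f x) \<le> B / (1 + x)\<^sup>2"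
    using schwartz_decay[OF f, of 0] by auto
  have "continuous_on UNIV f"
    using smooth_continuous_on[OF schwartz_imp_smooth[OF f], of _ 0] by simp
  then have [measurable]: "f \<in> borel_measurable borel"
    by (rule borel_measurable_continuous_onI)
  have "set_integrable lborel {0..} (\<lambda>x. B * (1 / (1 + x)\<^sup>2))"
    by (intro set_integrable_mult_right set_integrable_inverse_square)
  then show ?thesis
    by (rule set_integrable_bound) (use B in \<open>auto simp: set_borel_measurable_def\<close>)
qed

lemma schwartz_integral_tendsto:
  assumes "f \<in> schwartz"
  shows "((\<lambda>x. integral {0..x} f) \<longlongrightarrow> (LINT x:{0..}|lborel. f x)) at_top"
proof -
  have int: "set_integrable lborel {0..} f" by (rule schwartz_set_integrable[OF assms])
  have "integral {0..x} f = (LINT t:{0..x}|lborel. f t)" for x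
    by (rule set_borel_integral_eq_integral(2)[symmetric]) (rule set_integrable_subset[OF int]; auto)
  then show ?thesis
    using tendsto_set_lebesgue_integral_at_top[OF _ int] by simp
qed

lemma schwartz_tendsto_0:
  assumes "f \<in> schwartz"
  shows "(f \<longlongrightarrow> 0) at_top"
proof -
  obtain B where B: "B > 0" "\<And>x. x \<ge> 0 \<Longrightarrow> norm (f x) \<le> B / (1 + x)\<^sup>2"
    using schwartz_decay[OF assms, of 0] by auto
  have "((\<lambda>x. B / (1 + x)\<^sup>2) \<longlongrightarrow> 0) at_top"
    by (intro real_tendsto_divide_at_top[OF tendsto_const] filterlim_pow_at_top
        filterlim_tendsto_add_at_top[OF tendsto_const] filterlim_ident) auto
  then show ?thesis
    by (rule Lim_null_comparison[rotated])
       (use B in \<open>auto intro!: eventually_mono[OF eventually_ge_at_top[of 0]]\<close>)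
qed

text \<open>Apply the fundamental theorem on \<open>[0, x]\<close> and let \<open>x\<close> tend to
  infinity. This turns the constant terms in the expansions of the derivatives into boundary values
  at \<open>0\<close>.\<close>

lemma schwartz_integral_deriv:
  assumes "f \<in> schwartz"
  shows "(LINT x:{0..}|lborel. nth_deriv (Suc n) f x) = - nth_deriv n f 0"
proof -
  have "eventually (\<lambda>x. integral {0..x} (nth_deriv (Suc n) f) = nth_deriv n f x - nth_deriv n f 0) at_top"
    using eventually_ge_at_top[of 0]
  proof eventually_elim
    case (elim x)
    then show ?case
      using smooth_has_vector_derivative[OF schwartz_imp_smooth[OF assms]]
      by (intro integral_unique fundamental_theorem_of_calculus) auto
  qed
  moreover have "((\<lambda>x. nth_deriv n f x - nth_deriv n f 0) \<longlongrightarrow> 0 - nth_deriv n f 0) at_top"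
    by (intro tendsto_intros schwartz_tendsto_0 nth_deriv_in_schwartz assms)
  ultimately have "((\<lambda>x. integral {0..x} (nth_deriv (Suc n) f)) \<longlongrightarrow> 0 - nth_deriv n f 0) at_top"
    by (simp add: tendsto_cong)
  with schwartz_integral_tendsto[OF nth_deriv_in_schwartz[OF assms, of "Suc n"]] show ?thesis
    by (metis tendsto_unique trivial_limit_at_top_linorder diff_0)
qed

section \<open>Asymptotic expansions\<close>

lemma schwartz_sums_twisted_riemann_sum:
  assumes "f \<in> schwartz" "norm \<omega> = 1" "N > 0"
  shows "(\<lambda>k. \<omega> ^ k * f (real k / real N)) sums (of_nat N * twisted_riemann_sum \<omega> N f)"
  using summable_sums[OF schwartz_summable_grid[OF assms]] assms(3)
  by (simp add: twisted_riemann_sum_def)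

lemma riemann_sum_eq_twisted: "riemann_sum N f = twisted_riemann_sum 1 N f"
  by (simp add: riemann_sum_def twisted_riemann_sum_def)

lemma sums_Taylor_terms:
  assumes f: "f \<in> schwartz" and \<omega>: "norm \<omega> = 1" and N: "N > 0"
  shows "(\<lambda>k. \<omega> ^ k * (\<Sum>j<M. r j *\<^sub>R nth_deriv j f (real k / real N))) sums
    (of_nat N * (\<Sum>j<M. of_real (r j) * twisted_riemann_sum \<omega> N (nth_deriv j f)))"
proof -
  have "(\<lambda>k. \<Sum>j<M. of_real (r j) * (\<omega> ^ k * nth_deriv j f (real k / real N))) sums
    (\<Sum>j<M. of_real (r j) * (of_nat N * twisted_riemann_sum \<omega> N (nth_deriv j f)))"
    by (intro sums_sum sums_mult schwartz_sums_twisted_riemann_sum nth_deriv_in_schwartz assms)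
  then show ?thesis
    by (simp add: sum_distrib_left scaleR_conv_of_real mult_ac)
qed

text \<open>Shifting the summation index by one loses only the term \<open>f 0\<close>. In the
  Taylor expansion of the shifted sum the term \<open>j = 0\<close> is \<open>\<omega>\<close> times
  the original sum; moving it to the left leaves the factor \<open>1 - \<omega>\<close>, which is
  divided out.\<close>

lemma twisted_riemann_sum_recursion:
  assumes f: "f \<in> schwartz" and \<omega>: "norm \<omega> = 1" "\<omega> \<noteq> 1" and "M > 0"
  shows "(\<lambda>N. twisted_riemann_sum \<omega> N f - f 0 / (1 - \<omega>) / of_nat N
      - (\<Sum>j=1..<M. \<omega> / ((1 - \<omega>) * fact j) * twisted_riemann_sum \<omega> N (nth_deriv j f) / of_nat N ^ j))
    \<in> O[sequentially](\<lambda>N. 1 / of_nat N ^ M)"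
proof -
  let ?T = "twisted_riemann_sum \<omega>"
  obtain B where B: "\<And>x h. x \<ge> 0 \<Longrightarrow> h \<ge> 0 \<Longrightarrow>
      norm (f (x + h) - (\<Sum>j<M. (h ^ j / fact j) *\<^sub>R nth_deriv j f x)) \<le> B * h ^ M / (1 + x)\<^sup>2"
    using schwartz_Taylor_step[OF f \<open>M > 0\<close>] by blast
  have bound: "norm (?T N f - f 0 / (1 - \<omega>) / of_nat N
      - (\<Sum>j=1..<M. \<omega> / ((1 - \<omega>) * fact j) * ?T N (nth_deriv j f) / of_nat N ^ j))
      \<le> 2 * B / norm (1 - \<omega>) * norm (1 / of_nat N ^ M :: complex)" if N: "N > 0" for N
  proof -
    \<comment> \<open>Dividing by \<open>norm (1 - \<omega>) * N\<close> cancels the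
      \<open>N\<close> lost in summing the remainders.\<close>
    have scale: "norm E \<le> 2 * B / norm (1 - \<omega>) * norm (1 / of_nat N ^ M :: complex)"
      if "norm ((1 - \<omega>) * of_nat N * E) \<le> 2 * (B * (1 / real N) ^ M) * real N" for E
    proof -
      define c where "c = norm (1 - \<omega>)"
      have "c > 0" using \<omega> by (simp add: c_def)
      then show ?thesis
        using that N unfolding norm_mult c_def[symmetric]
        by (simp add: norm_divide norm_power power_one_over field_simps)
    qed
    define r where "r j = (1 / real N) ^ j / fact j" for j
    define P where "P k = (\<Sum>j<M. r j *\<^sub>R nth_deriv j f (real k / real N))" for k
    define g where "g k = \<omega> ^ Suc k * (f (real (Suc k) / real N) - P k)" for k
    define S where "S = (\<Sum>j=1..<M. of_real (r j) * ?T N (nth_deriv j f))"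
    have norm_g: "norm (g k) \<le> B * (1 / real N) ^ M / (1 + real k / real N)\<^sup>2" for k
      using B[of "real k / real N" "1 / real N"] N \<omega>
      by (simp add: g_def P_def r_def norm_mult norm_power add_divide_distrib add_ac del: power_Suc)
    have "(\<lambda>k. \<omega> ^ Suc k * f (real (Suc k) / real N)) sums (of_nat N * ?T N f - f 0)"
      using schwartz_sums_twisted_riemann_sum[OF f \<omega>(1) N]
        sums_Suc_iff[of "\<lambda>k. \<omega> ^ k * f (real k / real N)"] by simp
    moreover have "(\<lambda>k. \<omega> * (\<omega> ^ k * P k)) sums
        (\<omega> * (of_nat N * (\<Sum>j<M. of_real (r j) * ?T N (nth_deriv j f))))"
      unfolding P_def by (intro sums_mult sums_Taylor_terms f \<omega> N)
    moreover have "(\<Sum>j<M. of_real (r j) * ?T N (nth_deriv j f)) = ?T N f + S"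
      using \<open>M > 0\<close> by (simp add: S_def r_def lessThan_atLeast0 sum.atLeast_Suc_lessThan)
    moreover have "g = (\<lambda>k. \<omega> ^ Suc k * f (real (Suc k) / real N) - \<omega> * (\<omega> ^ k * P k))"
      by (simp add: g_def fun_eq_iff right_diff_distrib mult.assoc)
    ultimately have "g sums (of_nat N * ?T N f - f 0 - \<omega> * (of_nat N * (?T N f + S)))"
      by (simp only: sums_diff)
    then have "norm (of_nat N * ?T N f - f 0 - \<omega> * (of_nat N * (?T N f + S))) \<le> 2 * (B * (1 / real N) ^ M) * real N"
      using norm_suminf_grid_decay_le[OF N norm_g] by (simp add: sums_iff)
    also have "of_nat N * ?T N f - f 0 - \<omega> * (of_nat N * (?T N f + S))
        = (1 - \<omega>) * of_nat N * (?T N f - f 0 / (1 - \<omega>) / of_nat N - \<omega> / (1 - \<omega>) * S)"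
    proof -
      define c where "c = 1 - \<omega>"
      have "c \<noteq> 0" "\<omega> = 1 - c" using \<omega> by (auto simp: c_def)
      then show ?thesis using N by (simp flip: c_def) (simp add: field_simps)
    qed
    also have "\<omega> / (1 - \<omega>) * S = (\<Sum>j=1..<M. \<omega> / ((1 - \<omega>) * fact j) * ?T N (nth_deriv j f) / of_nat N ^ j)"
      by (simp add: S_def r_def sum_distrib_left power_one_over mult_ac divide_simps)
    finally show ?thesis
      by (rule scale)
  qed
  show ?thesis
    by (rule bigoI, rule eventually_mono[OF eventually_gt_at_top[of 0] bound])
qed

text \<open>The integrals over the grid cells telescope to the full integral. Taylor term
  \<open>j\<close> sums to \<open>N^(-j) / (j+1)!\<close> times the Riemann sum of the
  \<open>j\<close>-th derivative; term \<open>0\<close> is the Riemann sum itself, and moving the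
  others across gives the minus sign.\<close>

lemma riemann_sum_recursion:
  assumes f: "f \<in> schwartz" and "M > 0"
  shows "(\<lambda>N. riemann_sum N f - (LINT x:{0..}|lborel. f x)
      - (\<Sum>j=1..<M. - 1 / fact (Suc j) * riemann_sum N (nth_deriv j f) / of_nat N ^ j))
    \<in> O[sequentially](\<lambda>N. 1 / of_nat N ^ M)"
proof -
  define I where "I = (LINT x:{0..}|lborel. f x)"
  obtain B where B: "\<And>x h. x \<ge> 0 \<Longrightarrow> h \<ge> 0 \<Longrightarrow>
      norm (integral {0..x + h} f - integral {0..x} f - (\<Sum>j<M. (h ^ Suc j / fact (Suc j)) *\<^sub>R nth_deriv j f x))
        \<le> B * h ^ Suc M / (1 + x)\<^sup>2"
    using schwartz_Taylor_step_integral[OF f] by blast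
  have bound: "norm (riemann_sum N f - I
      - (\<Sum>j=1..<M. - 1 / fact (Suc j) * riemann_sum N (nth_deriv j f) / of_nat N ^ j))
      \<le> 2 * B * norm (1 / of_nat N ^ M :: complex)" if N: "N > 0" for N
  proof -
    define r where "r j = (1 / real N) ^ Suc j / fact (Suc j)" for j
    define P where "P k = (\<Sum>j<M. r j *\<^sub>R nth_deriv j f (real k / real N))" for k
    define \<Phi> where "\<Phi> k = integral {0..real k / real N} f" for k
    define g where "g k = \<Phi> (Suc k) - \<Phi> k - P k" for k
    define S where "S = (\<Sum>j=1..<M. - 1 / fact (Suc j) * riemann_sum N (nth_deriv j f) / of_nat N ^ j)"
    have norm_g: "norm (g k) \<le> B * (1 / real N) ^ Suc M / (1 + real k / real N)\<^sup>2" for k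
      using B[of "real k / real N" "1 / real N"] N
      by (simp add: g_def P_def r_def \<Phi>_def add_divide_distrib add_ac del: power_Suc fact_Suc)
    have "filterlim (\<lambda>k. 1 / real N * real k) at_top sequentially"
      using N by (intro filterlim_tendsto_pos_mult_at_top[OF tendsto_const] filterlim_real_sequentially) auto
    then have "filterlim (\<lambda>k. real k / real N) at_top sequentially"
      by simp
    then have "\<Phi> \<longlonglongrightarrow> I"
      unfolding \<Phi>_def I_def by (rule filterlim_compose[OF schwartz_integral_tendsto[OF f]])
    then have "(\<lambda>k. \<Phi> (Suc k) - \<Phi> k) sums (I - \<Phi> 0)"
      by (rule telescope_sums)
    then have "(\<lambda>k. \<Phi> (Suc k) - \<Phi> k) sums I"
      by (simp add: \<Phi>_def)
    moreover have "P sums (of_nat N * (\<Sum>j<M. of_real (r j) * riemann_sum N (nth_deriv j f)))"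
      unfolding P_def using sums_Taylor_terms[OF f _ N, of 1] by (simp add: riemann_sum_eq_twisted)
    moreover have "of_nat N * (\<Sum>j<M. of_real (r j) * riemann_sum N (nth_deriv j f)) = riemann_sum N f - S"
    proof -
      have "of_nat N * (\<Sum>j<M. of_real (r j) * riemann_sum N (nth_deriv j f))
          = (\<Sum>j<M. 1 / fact (Suc j) * riemann_sum N (nth_deriv j f) / of_nat N ^ j)"
        unfolding sum_distrib_left
        using N by (intro sum.cong refl) (simp add: r_def power_one_over divide_simps del: fact_Suc)
      then show ?thesis
        using \<open>M > 0\<close> by (simp add: S_def lessThan_atLeast0 sum.atLeast_Suc_lessThan sum_negf)
    qed
    ultimately have "g sums (I - (riemann_sum N f - S))"
      unfolding g_def by (simp only: sums_diff)
    then have "norm (I - (riemann_sum N f - S)) \<le> 2 * (B * (1 / real N) ^ Suc M) * real N"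
      using norm_suminf_grid_decay_le[OF N norm_g] by (simp add: sums_iff)
    also have "norm (I - (riemann_sum N f - S)) = norm (riemann_sum N f - I - S)"
      by (subst norm_minus_commute) (simp add: algebra_simps)
    finally have "norm (riemann_sum N f - I - S) \<le> 2 * B * norm (1 / of_nat N ^ M :: complex)"
      using N by (simp add: norm_divide norm_power power_one_over field_simps)
    then show ?thesis
      by (simp only: S_def)
  qed
  show ?thesis
    unfolding I_def[symmetric]
    by (rule bigoI, rule eventually_mono[OF eventually_gt_at_top[of 0] bound])
qed

text \<open>Strong induction on \<open>M\<close>, for all \<open>f\<close> at once:
  \<open>T N (d j f)\<close> carries the factor \<open>N^(-j)\<close>, so its expansion with
  \<open>M - j\<close> terms suffices. The recurrence for \<open>X\<close> is what collecting equal
  powers of \<open>1 / N\<close> produces.\<close>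

lemma asymptotic_expansion_from_recursion:
  fixes T A X :: "nat \<Rightarrow> 'f \<Rightarrow> complex" and b :: "nat \<Rightarrow> complex" and d :: "nat \<Rightarrow> 'f \<Rightarrow> 'f"
  assumes d: "\<And>f j. f \<in> F \<Longrightarrow> d j f \<in> F"
    and rec: "\<And>f M. f \<in> F \<Longrightarrow> M > 0 \<Longrightarrow>
      (\<lambda>N. T N f - (\<Sum>n\<le>M. A n f / of_nat N ^ n) - (\<Sum>j=1..<M. b j * T N (d j f) / of_nat N ^ j))
        \<in> O[sequentially](\<lambda>N. 1 / of_nat N ^ M)"
    and X: "\<And>f n. f \<in> F \<Longrightarrow> X n f = A n f + (\<Sum>j=1..n. b j * X (n - j) (d j f))"
    and "f \<in> F"
  shows "asymptotic_expansion (\<lambda>N. T N f) (\<lambda>n. X n f)"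
  unfolding asymptotic_expansion_def
proof (intro allI impI)
  fix M :: nat assume "M \<ge> 1"
  with \<open>f \<in> F\<close> show "(\<lambda>N. T N f - (\<Sum>n<M. X n f / of_nat N ^ n)) \<in> O(\<lambda>N. 1 / of_nat N ^ M)"
  proof (induction M arbitrary: f rule: less_induct)
    case (less M)
    define E where "E j N = T N (d j f) - (\<Sum>n<M - j. X n (d j f) / of_nat N ^ n)" for j N
    have "(\<lambda>N. (b j / of_nat N ^ j) * E j N) \<in> O(\<lambda>N. 1 / of_nat N ^ M)" if "j \<in> {1..<M}" for j
    proof -
      have "(\<lambda>N. b j / of_nat N ^ j) \<in> O(\<lambda>N. 1 / of_nat N ^ j)"
        by (intro bigoI[of _ "norm (b j)"]) (simp add: norm_divide)
      then have "(\<lambda>N. (b j / of_nat N ^ j) * E j N) \<in> O(\<lambda>N. (1 / of_nat N ^ j) * (1 / of_nat N ^ (M - j)))"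
        unfolding E_def by (intro landau_o.big.mult less.IH) (use that d less.prems in auto)
      moreover have "(1 / of_nat N ^ j) * (1 / of_nat N ^ (M - j)) = (1 / of_nat N ^ M :: complex)" for N
        using that by (simp flip: power_add)
      ultimately show ?thesis by simp
    qed
    then have bE: "(\<lambda>N. \<Sum>j=1..<M. (b j / of_nat N ^ j) * E j N) \<in> O(\<lambda>N. 1 / of_nat N ^ M)"
      by (rule big_sum_in_bigo)
    \<comment> \<open>The recursion includes the explicit term of index \<open>M\<close>, so that
      the twisted term of index \<open>1\<close> is present already for \<open>M = 1\<close>. The
      expansion stops before \<open>M\<close>, and this last term is absorbed into the
      error.\<close>
    have AM: "(\<lambda>N. A M f / of_nat N ^ M) \<in> O(\<lambda>N. 1 / of_nat N ^ M)"
      by (intro bigoI[of _ "norm (A M f)"]) (simp add: norm_divide)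
    have "(\<lambda>N. (T N f - (\<Sum>n\<le>M. A n f / of_nat N ^ n) - (\<Sum>j=1..<M. b j * T N (d j f) / of_nat N ^ j))
        + A M f / of_nat N ^ M + (\<Sum>j=1..<M. (b j / of_nat N ^ j) * E j N)) \<in> O(\<lambda>N. 1 / of_nat N ^ M)"
      using less.prems by (intro sum_in_bigo(1)[OF sum_in_bigo(1)[OF rec AM] bE]) auto
    also have "(\<lambda>N. (T N f - (\<Sum>n\<le>M. A n f / of_nat N ^ n) - (\<Sum>j=1..<M. b j * T N (d j f) / of_nat N ^ j))
        + A M f / of_nat N ^ M + (\<Sum>j=1..<M. (b j / of_nat N ^ j) * E j N))
        = (\<lambda>N. T N f - (\<Sum>n<M. X n f / of_nat N ^ n))"
    proof
      fix N
      \<comment> \<open>Reorder the double sum by the total power of \<open>1 / N\<close>, which is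
        \<open>n + j\<close>.\<close>
      have "(\<Sum>j=1..<M. \<Sum>n<M - j. b j * X n (d j f) / (of_nat N ^ j * of_nat N ^ n))
          = (\<Sum>n<M. \<Sum>j=1..n. b j * X (n - j) (d j f) / of_nat N ^ n)"
        unfolding sum.Sigma[OF finite_atLeastLessThan ballI[OF finite_lessThan]]
          sum.Sigma[OF finite_lessThan ballI[OF finite_atLeastAtMost]]
        by (rule sum.reindex_bij_witness[of _ "\<lambda>(n, j). (j, n - j)" "\<lambda>(j, n). (n + j, j)"])
           (auto simp: power_add mult_ac)
      moreover have "(\<Sum>n<M. X n f / of_nat N ^ n)
          = (\<Sum>n<M. A n f / of_nat N ^ n) + (\<Sum>n<M. \<Sum>j=1..n. b j * X (n - j) (d j f) / of_nat N ^ n)"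
        by (subst X[OF less.prems(1)]) (simp add: add_divide_distrib sum.distrib sum_divide_distrib)
      moreover have "(\<Sum>j=1..<M. (b j / of_nat N ^ j) * E j N) = (\<Sum>j=1..<M. b j * T N (d j f) / of_nat N ^ j)
          - (\<Sum>j=1..<M. \<Sum>n<M - j. b j * X n (d j f) / (of_nat N ^ j * of_nat N ^ n))"
        by (simp add: E_def right_diff_distrib sum_subtractf sum_distrib_left)
      ultimately show "(T N f - (\<Sum>n\<le>M. A n f / of_nat N ^ n) - (\<Sum>j=1..<M. b j * T N (d j f) / of_nat N ^ j))
        + A M f / of_nat N ^ M + (\<Sum>j=1..<M. (b j / of_nat N ^ j) * E j N)
        = T N f - (\<Sum>n<M. X n f / of_nat N ^ n)"
        by (simp add: lessThan_Suc_atMost[symmetric])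
    qed
    finally show ?case .
  qed
qed

section \<open>The two expansions\<close>

lemma twisted_riemann_sum_expansion:
  assumes "f \<in> schwartz" and \<omega>: "norm \<omega> = 1" "\<omega> \<noteq> 1"
  shows "asymptotic_expansion (\<lambda>N. twisted_riemann_sum \<omega> N f)
    (\<lambda>n. if n = 0 then 0 else twisted_coeff \<omega> n * nth_deriv (n - 1) f 0)"
proof (rule asymptotic_expansion_from_recursion[where F = schwartz and d = nth_deriv
    and T = "twisted_riemann_sum \<omega>" and b = "\<lambda>j. \<omega> / ((1 - \<omega>) * fact j)"
    and A = "\<lambda>n f. if n = 1 then f 0 / (1 - \<omega>) else 0"
    and X = "\<lambda>n f. if n = 0 then 0 else twisted_coeff \<omega> n * nth_deriv (n - 1) f 0"])
  fix f :: "real \<Rightarrow> complex" and M :: nat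
  assume f: "f \<in> schwartz" "M > 0"
  have "(\<Sum>n\<le>M. (if n = 1 then f 0 / (1 - \<omega>) else 0) / of_nat N ^ n) = f 0 / (1 - \<omega>) / of_nat N" for N
    using f(2) by (subst sum.remove[of _ 1]) auto
  with twisted_riemann_sum_recursion[OF f(1) \<omega> f(2)]
  show "(\<lambda>N. twisted_riemann_sum \<omega> N f - (\<Sum>n\<le>M. (if n = 1 then f 0 / (1 - \<omega>) else 0) / of_nat N ^ n)
      - (\<Sum>j=1..<M. \<omega> / ((1 - \<omega>) * fact j) * twisted_riemann_sum \<omega> N (nth_deriv j f) / of_nat N ^ j))
    \<in> O(\<lambda>N. 1 / of_nat N ^ M)"
    by simp
next
  fix f :: "real \<Rightarrow> complex" and n :: nat
  assume f: "f \<in> schwartz"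
  show "(if n = 0 then 0 else twisted_coeff \<omega> n * nth_deriv (n - 1) f 0)
    = (if n = 1 then f 0 / (1 - \<omega>) else 0) + (\<Sum>j=1..n. \<omega> / ((1 - \<omega>) * fact j) *
        (if n - j = 0 then 0 else twisted_coeff \<omega> (n - j) * nth_deriv (n - j - 1) (nth_deriv j f) 0))"
  proof (cases n)
    case 0
    then show ?thesis by simp
  next
    case (Suc m)
    define s where "s = (\<Sum>j=1..m. twisted_coeff \<omega> (Suc (m - j)) / fact j)"
    \<comment> \<open>The term \<open>j = 0\<close> of the coefficient recurrence contains
      \<open>twisted_coeff \<omega> n\<close> itself and is moved to the left.\<close>
    have "(1 - \<omega>) * twisted_coeff \<omega> n = (if m = 0 then 1 else 0) + \<omega> * s"
      using twisted_coeff_rec[OF \<omega>(2), of m]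
      by (simp add: Suc s_def atMost_atLeast0 sum.atLeast_Suc_atMost algebra_simps split: if_splits)
    then have "twisted_coeff \<omega> n = ((if m = 0 then 1 else 0) + \<omega> * s) / (1 - \<omega>)"
      using \<omega>(2) by (subst nonzero_eq_divide_eq) (simp_all add: mult.commute)
    then have "twisted_coeff \<omega> n = (if n = 1 then 1 / (1 - \<omega>) else 0) + \<omega> / (1 - \<omega>) * s"
      by (simp add: Suc add_divide_distrib)
    \<comment> \<open>The term \<open>j = n\<close> vanishes because the expansion has no constant
      term. In all others the derivative orders add up to \<open>m\<close>.\<close>
    moreover have "(\<Sum>j=1..n. \<omega> / ((1 - \<omega>) * fact j) *
        (if n - j = 0 then 0 else twisted_coeff \<omega> (n - j) * nth_deriv (n - j - 1) (nth_deriv j f) 0))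
        = \<omega> / (1 - \<omega>) * s * nth_deriv m f 0"
      by (auto simp: Suc s_def sum_distrib_left sum_distrib_right Suc_diff_le mult_ac intro!: sum.cong)
    ultimately show ?thesis
      by (simp add: Suc algebra_simps)
  qed
qed (auto intro: nth_deriv_in_schwartz assms)

lemma riemann_sum_expansion:
  assumes "f \<in> schwartz"
  shows "asymptotic_expansion (\<lambda>N. riemann_sum N f)
    (\<lambda>n. if n = 0 then (LINT x:{0..}|lborel. f x) else untwisted_coeff n * nth_deriv (n - 1) f 0)"
proof (rule asymptotic_expansion_from_recursion[where F = schwartz and d = nth_deriv
    and T = riemann_sum and b = "\<lambda>j. - 1 / fact (Suc j)"
    and A = "\<lambda>n f. if n = 0 then (LINT x:{0..}|lborel. f x) else 0"
    and X = "\<lambda>n f. if n = 0 then (LINT x:{0..}|lborel. f x) else untwisted_coeff n * nth_deriv (n - 1) f 0"])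
  fix f :: "real \<Rightarrow> complex" and M :: nat
  assume f: "f \<in> schwartz" "M > 0"
  have "(\<Sum>n\<le>M. (if n = 0 then (LINT x:{0..}|lborel. f x) else 0) / of_nat N ^ n) = (LINT x:{0..}|lborel. f x)" for N
    by (subst sum.remove[of _ 0]) auto
  with riemann_sum_recursion[OF f]
  show "(\<lambda>N. riemann_sum N f - (\<Sum>n\<le>M. (if n = 0 then (LINT x:{0..}|lborel. f x) else 0) / of_nat N ^ n)
      - (\<Sum>j=1..<M. - 1 / fact (Suc j) * riemann_sum N (nth_deriv j f) / of_nat N ^ j))
    \<in> O(\<lambda>N. 1 / of_nat N ^ M)"
    by simp
next
  fix f :: "real \<Rightarrow> complex" and n :: nat
  assume f: "f \<in> schwartz"
  let ?X = "\<lambda>n f. if n = 0 then (LINT x:{0..}|lborel. f x) else untwisted_coeff n * nth_deriv (n - 1) f 0"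
  show "?X n f = (if n = 0 then (LINT x:{0..}|lborel. f x) else 0) +
      (\<Sum>j=1..n. - 1 / fact (Suc j) * ?X (n - j) (nth_deriv j f))"
  proof (cases n)
    case 0
    then show ?thesis by simp
  next
    case (Suc m)
    \<comment> \<open>For \<open>j = n\<close> the entry is the integral of the \<open>n\<close>-th
      derivative, that is \<open>- nth_deriv m f 0\<close>. The value \<open>-1\<close> of the
      coefficient of index \<open>0\<close> lets it follow the same formula as the other
      terms.\<close>
    have "untwisted_coeff 0 = - 1"
      using untwisted_coeff_rec[of 0] by simp
    then have X: "?X (n - j) (nth_deriv j f) = untwisted_coeff (n - j) * nth_deriv m f 0" if "j \<in> {1..n}" for j
      using that schwartz_integral_deriv[OF f, of m] Suc by (cases "j = n") auto
    have "untwisted_coeff n + (\<Sum>j=1..n. untwisted_coeff (n - j) / fact (Suc j)) = 0"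
      using untwisted_coeff_rec[of n]
      by (simp add: Suc atMost_atLeast0 sum.atLeast_Suc_atMost add.assoc del: fact_Suc)
    then have "untwisted_coeff n = - (\<Sum>j=1..n. untwisted_coeff (n - j) / fact (Suc j))"
      by (simp only: eq_neg_iff_add_eq_0)
    then have "untwisted_coeff n * nth_deriv m f 0 =
        (\<Sum>j=1..n. - 1 / fact (Suc j) * (untwisted_coeff (n - j) * nth_deriv m f 0))"
      by (simp add: sum_distrib_right sum_negf del: fact_Suc)
    then show ?thesis
      using X by (simp add: Suc del: fact_Suc)
  qed
qed (auto intro: nth_deriv_in_schwartz assms)

theorem proposition2p3:
  fixes \<omega> :: complex and q :: nat
  assumes "q > 0" and "\<omega> ^ q = 1"
  shows "(\<omega> \<noteq> 1 \<longrightarrow>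
            (\<forall>\<phi> \<in> compactly_supported_smooth.
               asymptotic_expansion (\<lambda>N. twisted_riemann_sum \<omega> N \<phi>)
                 (\<lambda>n. if n = 0 then 0 else twisted_coeff \<omega> n * nth_deriv (n - 1) \<phi> 0)))
       \<and> (\<omega> = 1 \<longrightarrow>
            (\<forall>\<phi> \<in> schwartz.
               asymptotic_expansion (\<lambda>N. riemann_sum N \<phi>)
                 (\<lambda>n. if n = 0 then (LINT x:{0..}|lborel. \<phi> x)
                      else untwisted_coeff n * nth_deriv (n - 1) \<phi> 0)))"
proof -
  have "norm \<omega> ^ q = 1 ^ q"
    using assms(2) by (simp flip: norm_power)
  then have "norm \<omega> = 1"
    by (rule power_eq_imp_eq_base) (use assms(1) in auto)
  \<comment> \<open>The twisted expansion, proved for all Schwartz functions, is specialised to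
    compact support by inclusion.\<close>
  then show ?thesis
    using twisted_riemann_sum_expansion riemann_sum_expansion compactly_supported_smooth_subset_schwartz
    by blast
qed

end
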